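(* Let $d\ge 2$ and let $v_1,\dots,v_d$ be a unimodular sequence of vectors in $\mathbb{Z}^2$. For $i=1,\dots,d$ (indices taken cyclically modulo $d$, so $v_{d+1}=v_1$, $v_0=v_d$, $\epsilon_0=\epsilon_d$) put $\epsilon_i=\det(v_i,v_{i+1})\in\{1,-1\}$ and let $a_i$ be the unique integer with $$\epsilon_{i-1}v_{i-1}+\epsilon_i v_{i+1}+a_i v_i=0.$$ Then the rotation number of the sequence $v_1,\dots,v_d$ around the origin equals $$\frac{1}{12}\Big(\sum_{i=1}^d a_i+3\sum_{i=1}^d\epsilon_i\Big).$$
   Context: A sequence of vectors $v_1,\dots,v_d$ in $\mathbb{Z}^2$ ($d\ge 2$) is unimodular if, for every $i=1,\dots,d$ (with $v_{d+1}=v_1$), the triangle with vertices $\mathbf{0}=(0,0)$, $v_i$, $v_{i+1}$ contains no lattice point except its vertices; equivalently, $v_i,v_{i+1}$ form a basis of $\mathbb{Z}^2$, i.e. $\det(v_i,v_{i+1})=\pm1$. The vectors need not be in clockwise or counterclockwise order; they may go back and forth. The integers $a_i$ exist and are unique because each consecutive pair is a basis of $\mathbb{Z}^2$. The rotation number of $v_1,\dots,v_d$ around the origin is $\frac{1}{2\pi}\sum_{i=1}^d\theta_i$, where $\theta_i\in(-\pi,\pi)$ is the signed angle of the rotation of angle less than $\pi$ from the direction of $v_i$ to the direction of $v_{i+1}$ (counterclockwise being positive). So $\theta_i>0$ if $\epsilon_i=1$ and $\theta_i<0$ if $\epsilon_i=-1$. *)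

theory Defs
  imports "HOL-Analysis.Analysis"
begin

text \<open>The real plane containing the lattice is identified with the complex plane.\<close>

definition plane :: "int^2 \<Rightarrow> complex" where
  "plane v = Complex (of_int (v $ 1)) (of_int (v $ 2))"

definition det_pair :: "int^2 \<Rightarrow> int^2 \<Rightarrow> int" where
  "det_pair v w = det (vector [v, w] :: int^2^2)"

text \<open>The three points are required to be non-collinear: otherwise a degenerate
  ``triangle'' with \<open>v = w\<close> primitive would satisfy the lattice point condition although
  \<open>v\<close>, \<open>w\<close> is not a basis of the lattice (see \<open>empty_triangle_iff\<close> below).\<close>

definition empty_triangle :: "int^2 \<Rightarrow> int^2 \<Rightarrow> bool" where
  "empty_triangle v w \<longleftrightarrow>
     \<not> collinear {0, plane v, plane w} \<and>
     (convex hull {0, plane v, plane w}) \<inter> range plane = {0, plane v, plane w}"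

text \<open>A sequence of length \<open>d\<close> is a function on \<open>nat\<close> of which only the values at
  \<open>0, \<dots>, d - 1\<close> are used; indices are cyclic modulo \<open>d\<close>.\<close>

definition nxt :: "nat \<Rightarrow> nat \<Rightarrow> nat" where
  "nxt d i = (i + 1) mod d"

definition prv :: "nat \<Rightarrow> nat \<Rightarrow> nat" where
  "prv d i = (i + d - 1) mod d"

definition unimodular_seq :: "nat \<Rightarrow> (nat \<Rightarrow> int^2) \<Rightarrow> bool" where
  "unimodular_seq d v \<longleftrightarrow> (\<forall>i<d. empty_triangle (v i) (v (nxt d i)))"

definition eps :: "nat \<Rightarrow> (nat \<Rightarrow> int^2) \<Rightarrow> nat \<Rightarrow> int" where
  "eps d v i = det_pair (v i) (v (nxt d i))"

definition is_coeff :: "nat \<Rightarrow> (nat \<Rightarrow> int^2) \<Rightarrow> nat \<Rightarrow> int \<Rightarrow> bool" where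
  "is_coeff d v i a \<longleftrightarrow>
     eps d v (prv d i) *s v (prv d i) + eps d v i *s v (nxt d i) + a *s v i = 0"

definition coeff_a :: "nat \<Rightarrow> (nat \<Rightarrow> int^2) \<Rightarrow> nat \<Rightarrow> int" where
  "coeff_a d v i = (THE a. is_coeff d v i a)"

text \<open>The signed angle from the direction of \<open>v\<close> to that of \<open>w\<close>. The value \<open>pi\<close> of
  \<^const>\<open>Arg\<close> occurs only for opposite directions, which are excluded when \<open>v\<close>, \<open>w\<close> are
  linearly independent.\<close>

definition signed_angle :: "int^2 \<Rightarrow> int^2 \<Rightarrow> real" where
  "signed_angle v w = Arg (plane w / plane v)"

definition rotation_number :: "nat \<Rightarrow> (nat \<Rightarrow> int^2) \<Rightarrow> real" where
  "rotation_number d v = 1 / (2 * pi) * (\<Sum>i<d. signed_angle (v i) (v (nxt d i)))"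


lemma det_pair_eq: "det_pair v w = v $ 1 * w $ 2 - v $ 2 * w $ 1"
  by (simp add: det_pair_def det_2)

lemma plane_eq_iff [simp]: "plane v = plane w \<longleftrightarrow> v = w"
  by (auto simp: plane_def vec_eq_iff forall_2)

lemma plane_0 [simp]: "plane 0 = 0"
  by (simp add: plane_def complex_eq_iff)

lemma collinear_plane_iff: "collinear {0, plane v, plane w} \<longleftrightarrow> det_pair v w = 0"
proof -
  have "collinear {0, plane v, plane w} \<longleftrightarrow>
      (v $ 1 = 0 \<and> v $ 2 = 0) \<or> (w $ 1 = 0 \<and> w $ 2 = 0) \<or> (\<exists>c. plane w = c *\<^sub>R plane v)"
    unfolding collinear_lemma by (auto simp: plane_def complex_eq_iff)
  also have "\<dots> \<longleftrightarrow> det_pair v w = 0" (is "?L \<longleftrightarrow> ?R")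
  proof
    assume ?L
    moreover have ?R if "plane w = c *\<^sub>R plane v" for c
    proof -
      have *: "real_of_int (w $ 1) = c * v $ 1" "real_of_int (w $ 2) = c * v $ 2"
        using that by (auto simp: plane_def complex_eq_iff)
      have "real_of_int (det_pair v w) = 0"
        by (simp add: det_pair_eq *)
      then show ?R by simp
    qed
    ultimately show ?R by (auto simp: det_pair_eq)
  next
    assume R: ?R
    then have e: "real_of_int (v $ 1) * w $ 2 = v $ 2 * w $ 1"
      unfolding det_pair_eq by (metis eq_iff_diff_eq_0 of_int_mult)
    show ?L
    proof (cases "v $ 1 = 0")
      case True
      show ?thesis
      proof (cases "v $ 2 = 0")
        case False
        with True e have "w $ 1 = 0" by simp
        with True False have "plane w = (w $ 2 / v $ 2) *\<^sub>R plane v"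
          by (simp add: plane_def complex_eq_iff)
        then show ?thesis by blast
      qed (use True in simp)
    next
      case False
      with e have "plane w = (w $ 1 / v $ 1) *\<^sub>R plane v"
        by (simp add: plane_def complex_eq_iff field_simps)
      then show ?thesis by blast
    qed
  qed
  finally show ?thesis .
qed

lemma hull_plane:
  "convex hull {0, plane v, plane w} =
     {s *\<^sub>R plane v + t *\<^sub>R plane w | s t. 0 \<le> s \<and> 0 \<le> t \<and> s + t \<le> 1}"
  unfolding convex_hull_3_alt by simp

lemma empty_triangle_imp_det:
  assumes "empty_triangle v w"
  shows "\<bar>det_pair v w\<bar> = 1"
proof (rule ccontr)
  define D where "D = det_pair v w"
  have D0: "D \<noteq> 0"
    using assms by (auto simp: empty_triangle_def collinear_plane_iff D_def)
  assume "\<bar>det_pair v w\<bar> \<noteq> 1"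
  then have nd: "\<not> D dvd 1" by (simp add: D_def)
  have "\<exists>x. \<not> (D dvd det_pair x w \<and> D dvd det_pair v x)"
  proof (rule ccontr)
    assume "\<nexists>x. \<not> (D dvd det_pair x w \<and> D dvd det_pair v x)"
    then have all: "D dvd det_pair x w" "D dvd det_pair v x" for x by auto
    have "D dvd w $ 2" "D dvd - (w $ 1)" "D dvd - (v $ 2)" "D dvd v $ 1"
      using all(1)[of "vector [1, 0]"] all(1)[of "vector [0, 1]"]
        all(2)[of "vector [1, 0]"] all(2)[of "vector [0, 1]"]
      by (simp_all add: det_pair_eq)
    then have "D dvd w $ 2" "D dvd w $ 1" "D dvd v $ 2" "D dvd v $ 1" by simp_all
    then obtain p q r s where *: "w $ 2 = D * p" "w $ 1 = D * q" "v $ 2 = D * r" "v $ 1 = D * s"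
      by (elim dvdE) blast
    have "D = D * (D * (s * p - r * q))"
      by (subst D_def) (simp add: det_pair_eq * algebra_simps)
    with D0 have "1 = D * (s * p - r * q)" by simp
    with nd show False by (metis dvd_triv_left)
  qed
  then obtain x where x: "\<not> (D dvd det_pair x w \<and> D dvd det_pair v x)" by blast
  define q r where "q = det_pair x w div D" and "r = det_pair v x div D"
  define s t where "s = real_of_int (det_pair x w mod D) / D"
    and "t = real_of_int (det_pair v x mod D) / D"
  have bnd: "0 \<le> real_of_int (k mod D) / D \<and> real_of_int (k mod D) / D < 1" for k
  proof (cases "D > 0")
    case True then show ?thesis by (simp add: field_simps)
  next
    case False
    with D0 have "D < 0" by simp
    then have "D < k mod D" "k mod D \<le> 0" by auto
    with \<open>D < 0\<close> show ?thesis by (simp add: divide_simps)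
  qed
  have st: "0 \<le> s" "s < 1" "0 \<le> t" "t < 1" using bnd by (auto simp: s_def t_def)
  have nz: "s \<noteq> 0 \<or> t \<noteq> 0" using x D0 by (auto simp: s_def t_def dvd_eq_mod_eq_0)
  define y where "y = x - q *s v - r *s w"
  have sD: "s * D = det_pair x w - q * D" "t * D = det_pair v x - r * D"
    using D0 by (simp_all add: s_def t_def q_def r_def minus_div_mult_eq_mod [symmetric])
  have Dr: "real_of_int D = v $ 1 * w $ 2 - v $ 2 * w $ 1"
    by (simp add: D_def det_pair_eq)
  have Y: "plane y = s *\<^sub>R plane v + t *\<^sub>R plane w"
  proof -
    have "D * plane y = D * (s *\<^sub>R plane v + t *\<^sub>R plane w)"
    proof -
      have "D * (s *\<^sub>R plane v + t *\<^sub>R plane w) = (s * D) *\<^sub>R plane v + (t * D) *\<^sub>R plane w"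
        by (simp add: complex_eq_iff algebra_simps)
      also have "\<dots> = D * plane y"
        unfolding sD
        by (simp add: complex_eq_iff plane_def y_def det_pair_eq Dr algebra_simps)
      finally show ?thesis by metis
    qed
    then show ?thesis using D0 by simp
  qed
  have indep: "a = 0 \<and> b = 0" if "a *\<^sub>R plane v + b *\<^sub>R plane w = 0" for a b
  proof -
    have e: "a * v $ 1 + b * w $ 1 = 0" "a * v $ 2 + b * w $ 2 = 0"
      using that by (auto simp: plane_def complex_eq_iff)
    have "a * D = (a * v $ 1 + b * w $ 1) * w $ 2 - (a * v $ 2 + b * w $ 2) * w $ 1"
         "b * D = (a * v $ 2 + b * w $ 2) * v $ 1 - (a * v $ 1 + b * w $ 1) * v $ 2"
      unfolding Dr by (simp_all add: algebra_simps)
    then have "a * D = 0" "b * D = 0" unfolding e by simp_all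
    then show ?thesis using D0 by simp
  qed
  have key: False
    if "0 \<le> a" "a < 1" "0 \<le> b" "b < 1" "a \<noteq> 0 \<or> b \<noteq> 0" "a + b \<le> 1"
      and z: "plane z = a *\<^sub>R plane v + b *\<^sub>R plane w" for a b z
  proof -
    have "plane z \<in> (convex hull {0, plane v, plane w}) \<inter> range plane"
      unfolding hull_plane using that(1,3,6,7) by blast
    then have "plane z \<in> {0, plane v, plane w}"
      using assms unfolding empty_triangle_def by blast
    then consider "a *\<^sub>R plane v + b *\<^sub>R plane w = 0"
      | "(a - 1) *\<^sub>R plane v + b *\<^sub>R plane w = 0"
      | "a *\<^sub>R plane v + (b - 1) *\<^sub>R plane w = 0"
      unfolding z by (auto simp del: plane_eq_iff simp: algebra_simps)
    then show False using indep that by cases force+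
  qed
  show False
  proof (cases "s + t \<le> 1")
    case True
    then show False using key[of s t y] st nz Y by blast
  next
    case False
    have "plane (v + w - y) = (1 - s) *\<^sub>R plane v + (1 - t) *\<^sub>R plane w"
    proof -
      have "plane (v + w - y) = plane v + plane w - plane y"
        by (simp add: plane_def complex_eq_iff)
      then show ?thesis unfolding Y by (simp add: algebra_simps)
    qed
    then show False using key[of "1 - s" "1 - t" "v + w - y"] st False by auto
  qed
qed

lemma det_imp_empty_triangle:
  assumes "\<bar>det_pair v w\<bar> = 1"
  shows "empty_triangle v w"
proof -
  define D where "D = det_pair v w"
  have D: "D = 1 \<or> D = -1" using assms by (auto simp: D_def)
  have "plane z \<in> {0, plane v, plane w}" if "plane z \<in> convex hull {0, plane v, plane w}" for z
  proof -
    obtain s t where st: "0 \<le> s" "0 \<le> t" "s + t \<le> 1"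
      and z: "plane z = s *\<^sub>R plane v + t *\<^sub>R plane w"
      using \<open>plane z \<in> convex hull _\<close> unfolding hull_plane by auto
    have zz: "real_of_int (z $ 1) = s * v $ 1 + t * w $ 1"
             "real_of_int (z $ 2) = s * v $ 2 + t * w $ 2"
      using z by (auto simp: plane_def complex_eq_iff)
    have "real_of_int (det_pair z w) = s * D" "real_of_int (det_pair v z) = t * D"
      by (simp_all add: det_pair_eq zz D_def algebra_simps)
    then have "s = real_of_int (det_pair z w * D)" "t = real_of_int (det_pair v z * D)"
      using D by auto
    then obtain m n where mn: "s = real_of_int m" "t = real_of_int n" by blast
    with st have "0 \<le> m" "0 \<le> n" "m + n \<le> 1" by (simp_all flip: of_int_add)
    then have "m = 0 \<and> n = 0 \<or> m = 1 \<and> n = 0 \<or> m = 0 \<and> n = 1" by linarith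
    then show ?thesis using z mn by auto
  qed
  moreover have "{0, plane v, plane w} \<subseteq> convex hull {0, plane v, plane w}"
    by (rule hull_subset)
  moreover have "{0, plane v, plane w} \<subseteq> range plane"
    by (auto intro: range_eqI[of _ _ 0])
  ultimately show ?thesis
    using D by (auto simp: empty_triangle_def collinear_plane_iff D_def)
qed

lemma empty_triangle_iff: "empty_triangle v w \<longleftrightarrow> det_pair v w \<in> {1, -1}"
  using empty_triangle_imp_det[of v w] det_imp_empty_triangle[of v w] by auto

lemma ex1_is_coeff:
  assumes "unimodular_seq d v" "i < d"
  shows "\<exists>!a. is_coeff d v i a"
proof -
  define u w where "u = v (prv d i)" and "w = v (nxt d i)"
  have p: "prv d i < d" "nxt d (prv d i) = i"
    using assms(2) by (auto simp: prv_def nxt_def mod_simps)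
  define e f where "e = det_pair u (v i)" and "f = det_pair (v i) w"
  have ef: "e = 1 \<or> e = -1" "f = 1 \<or> f = -1"
    using assms p empty_triangle_iff unfolding unimodular_seq_def e_def f_def u_def w_def
    by (metis insert_iff singletonD)+
  have iff: "is_coeff d v i a \<longleftrightarrow> e *s u + f *s w + a *s v i = 0" for a
    using p by (simp add: is_coeff_def eps_def e_def f_def u_def w_def)
  define a where "a = - (e * f * det_pair u w)"
  have E: "e = u $ 1 * v i $ 2 - u $ 2 * v i $ 1" "f = v i $ 1 * w $ 2 - v i $ 2 * w $ 1"
    by (simp_all add: e_def f_def det_pair_eq)
  have ee: "e * e = 1" "f * f = 1" using ef by auto
  have cyc: "f * u $ k + e * w $ k = det_pair u w * v i $ k" if "k = 1 \<or> k = 2" for k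
    using that by (auto simp: E det_pair_eq algebra_simps)
  have comp: "e * u $ k + f * w $ k + a * v i $ k = 0" if "k = 1 \<or> k = 2" for k
  proof -
    have "e * u $ k + f * w $ k + a * v i $ k
        = e * u $ k + f * w $ k - e * f * (f * u $ k + e * w $ k)"
      using cyc[OF that] by (simp add: a_def)
    also have "\<dots> = 0" using ef by auto
    finally show ?thesis .
  qed
  show ?thesis
  proof (rule ex1I[of _ a])
    show "is_coeff d v i a"
      unfolding iff using comp by (simp add: vec_eq_iff forall_2)
  next
    fix b assume "is_coeff d v i b"
    then have "e * u $ k + f * w $ k + b * v i $ k = 0" for k
      unfolding iff by (simp add: vec_eq_iff)
    then have "b * v i $ k = a * v i $ k" if "k = 1 \<or> k = 2" for k
      using comp[OF that] by (metis add_left_cancel)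
    moreover have "v i $ 1 \<noteq> 0 \<or> v i $ 2 \<noteq> 0" using ef E by auto
    ultimately show "b = a" by auto
  qed
qed

end

theory Submission
  imports Defs
begin

text \<open>
  Pairing the relation that defines \<open>a\<^sub>i\<close> with \<open>v\<^sub>i\<close> under the Euclidean inner product gives
  \<open>a\<^sub>i \<bar>v\<^sub>i\<bar>\<^sup>2 = - \<epsilon>\<^sub>i\<^sub>-\<^sub>1 \<langle>v\<^sub>i\<^sub>-\<^sub>1, v\<^sub>i\<rangle> - \<epsilon>\<^sub>i \<langle>v\<^sub>i, v\<^sub>i\<^sub>+\<^sub>1\<rangle>\<close>. So \<open>a\<^sub>i\<close> is a sum of one term for each of the two
  steps at \<open>v\<^sub>i\<close>, and after collecting the terms by steps the theorem says that the sum of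
  \<open>W(x, y) = (6/\<pi>) \<theta>(x, y) - 3 det(x, y) + det(x, y) \<langle>x, y\<rangle> (1/\<bar>x\<bar>\<^sup>2 + 1/\<bar>y\<bar>\<^sup>2)\<close>
  over the steps \<open>x = v\<^sub>i\<close>, \<open>y = v\<^sub>i\<^sub>+\<^sub>1\<close> of the closed sequence is \<open>0\<close>.

  The function \<open>W\<close> is antisymmetric and does not change when \<open>x\<close> or \<open>y\<close> is replaced by its
  negative, so it is a function on the oriented edges of the Farey graph, whose vertices are the
  primitive vectors up to sign and whose edges are the bases of the lattice. The sum of \<open>W\<close> around
  each triangle \<open>x\<close>, \<open>x + y\<close>, \<open>y\<close> of that graph is \<open>0\<close>: the angles add up, the determinants
  contribute \<open>-3\<close> if \<open>det(x, y) = 1\<close>, and at each of the three vertices the two inner products,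
  signed and divided by the squared length, add up to \<open>1\<close> (lemma \<open>edge_weight_add\<close>).

  The Farey graph with its triangles filled in is simply connected, so \<open>W\<close> must be the difference
  \<open>G(y) - G(x)\<close> of a potential \<open>G\<close> on the vertices, and then its sum over a closed sequence
  telescopes. The potential is obtained by descending: two neighbours of \<open>z\<close> that are both shorter
  than \<open>z\<close> are equal up to sign or adjacent to each other (lemma \<open>shorter_neighbours\<close>), so adding up
  \<open>W\<close> along any path of vectors of increasing length from a unit vector to \<open>z\<close> gives the same
  value. Up to
  sign there is only one edge with ends of equal length, that between the two unit vectors, and
  there \<open>W\<close> is \<open>0\<close>.
\<close>

section \<open>Lattice bases as edges of the Farey graph\<close>

definition dot_pair :: "int^2 \<Rightarrow> int^2 \<Rightarrow> int" where
  "dot_pair x y = x $ 1 * y $ 1 + x $ 2 * y $ 2"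

definition adjacent :: "int^2 \<Rightarrow> int^2 \<Rightarrow> bool" where
  "adjacent x y \<longleftrightarrow> \<bar>det_pair x y\<bar> = 1"

lemma vec2_eq_iff: "x = y \<longleftrightarrow> x $ 1 = y $ 1 \<and> x $ 2 = y $ 2" for x y :: "int^2"
  by (simp add: vec_eq_iff forall_2)

lemma dot_pair_commute: "dot_pair x y = dot_pair y x"
  by (simp add: dot_pair_def)

lemma det_pair_commute: "det_pair y x = - det_pair x y"
  by (simp add: det_pair_eq)

lemma dot_pair_minus [simp]: "dot_pair (- x) y = - dot_pair x y" "dot_pair x (- y) = - dot_pair x y"
  by (simp_all add: dot_pair_def)

lemma det_pair_minus [simp]:
  "det_pair (- x) y = - det_pair x y" "det_pair x (- y) = - det_pair x y"
  by (simp_all add: det_pair_eq)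

lemma adjacent_commute: "adjacent x y \<longleftrightarrow> adjacent y x"
  by (simp add: adjacent_def det_pair_commute[of x y])

lemma adjacent_minus [simp]:
  "adjacent (- x) y \<longleftrightarrow> adjacent x y" "adjacent x (- y) \<longleftrightarrow> adjacent x y"
  by (simp_all add: adjacent_def)

lemma dot_pair_pos: "adjacent x y \<Longrightarrow> 0 < dot_pair x x"
  using sum_squares_gt_zero_iff[of "x $ 1" "x $ 2"]
  by (force simp: adjacent_def det_pair_eq dot_pair_def)

lemma lagrange_identity: "(dot_pair x y)\<^sup>2 + (det_pair x y)\<^sup>2 = dot_pair x x * dot_pair y y"
  by (simp add: dot_pair_def det_pair_eq power2_eq_square algebra_simps)

text \<open>
  Cramer's rule, written symmetrically in the three vectors. For neighbours in the Farey graph the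
  coefficients are \<open>0\<close> or \<open>\<plusminus>1\<close>, so it expresses one vector by the others up to signs.
\<close>

lemma cramer_identity:
  "det_pair y z * x $ k + det_pair z x * y $ k + det_pair x y * z $ k = 0"
proof -
  have "k = 1 \<or> k = 2" by (rule exhaust_2)
  then show ?thesis by (auto simp: det_pair_eq algebra_simps)
qed

text \<open>
  By \<open>lagrange_identity\<close>, \<open>\<bar>x\<bar>\<^sup>4 = \<langle>x, y\<rangle>\<^sup>2 + 1\<close>, and no two positive squares of integers differ
  by \<open>1\<close>. These edges are the ones at which the descent stops.
\<close>

lemma adjacent_same_length:
  assumes "adjacent x y" "dot_pair x x = dot_pair y y"
  shows "dot_pair x y = 0" "dot_pair x x = 1"
proof -
  have "(det_pair x y)\<^sup>2 = 1"
    using assms(1) unfolding adjacent_def by (metis power2_abs one_power2)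
  with lagrange_identity[of x y] assms(2)
  have *: "(dot_pair x x - \<bar>dot_pair x y\<bar>) * (dot_pair x x + \<bar>dot_pair x y\<bar>) = 1"
    by (simp add: power2_eq_square algebra_simps)
  moreover have pos: "0 < dot_pair x x" using assms(1) by (rule dot_pair_pos)
  ultimately have "dot_pair x x + \<bar>dot_pair x y\<bar> = 1"
    using zmult_eq_1_iff by fastforce
  with pos show "dot_pair x y = 0" "dot_pair x x = 1" by linarith+
qed

text \<open>
  This is what makes the descent independent of choices. In the direction orthogonal to \<open>z\<close>, both
  neighbours have components of size \<open>1/\<bar>z\<bar>\<close>, since their determinants with \<open>z\<close> are \<open>\<plusminus>1\<close>; being
  shorter than \<open>z\<close>, they have components less than \<open>\<bar>z\<bar>\<close> along \<open>z\<close>. Hence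
  \<open>\<bar>det(x, y)\<bar> < 2\<close>, and an integer of that size is \<open>0\<close> or \<open>\<plusminus>1\<close>.
\<close>

lemma shorter_neighbours:
  assumes "adjacent x z" "adjacent y z" "dot_pair x x < dot_pair z z" "dot_pair y y < dot_pair z z"
  shows "x = y \<or> x = - y \<or> adjacent x y"
proof -
  have bound: "\<bar>dot_pair u z\<bar> < dot_pair z z" if "adjacent u z" "dot_pair u u < dot_pair z z" for u
  proof -
    have pos: "0 < dot_pair u u" using that(1) by (rule dot_pair_pos)
    have "(dot_pair u z)\<^sup>2 \<le> dot_pair u u * dot_pair z z"
      using lagrange_identity[of u z] by (smt (verit) zero_le_power2)
    also have "\<dots> < (dot_pair z z)\<^sup>2"
      using that(2) pos by (simp add: power2_eq_square)
    finally show ?thesis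
      using pos that(2) power2_less_imp_less[of "\<bar>dot_pair u z\<bar>" "dot_pair z z"] by simp
  qed
  have "det_pair x y * dot_pair z z = det_pair z y * dot_pair x z + det_pair x z * dot_pair y z"
    by (simp add: dot_pair_def det_pair_eq algebra_simps)
  moreover have "det_pair z y = 1 \<or> det_pair z y = -1" "det_pair x z = 1 \<or> det_pair x z = -1"
    using assms(1,2) by (auto simp: adjacent_def det_pair_commute[of y z])
  ultimately have "\<bar>det_pair x y * dot_pair z z\<bar> < 2 * dot_pair z z"
    using bound[OF assms(1,3)] bound[OF assms(2,4)] by (elim disjE) auto
  then have "\<bar>det_pair x y\<bar> < 2"
    using assms(3) dot_pair_pos[OF assms(1)] by (simp add: abs_mult)
  moreover have "x = y \<or> x = - y" if "det_pair x y = 0"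
    using cramer_identity[of x y z 1] cramer_identity[of x y z 2] that assms(1,2)
    by (auto simp: cramer_identity adjacent_def vec2_eq_iff abs_if det_pair_commute[of x z] split: if_splits)
  ultimately show ?thesis
    by (auto simp: adjacent_def)
qed

lemma adjacent_triangle_linear:
  assumes "adjacent x y" "adjacent y z" "adjacent z x"
  shows "z = x + y \<or> z = x - y \<or> z = - x + y \<or> z = - x - y"
  using cramer_identity[of y z x 1] cramer_identity[of y z x 2] assms
  by (auto simp: adjacent_def vec2_eq_iff abs_if split: if_splits)

section \<open>Signed angles\<close>

lemma plane_minus [simp]: "plane (- x) = - plane x"
  by (simp add: plane_def complex_eq_iff)

lemma plane_add [simp]: "plane (x + y) = plane x + plane y"
  by (simp add: plane_def complex_eq_iff)

lemma Im_plane_divide: "Im (plane y / plane x) = det_pair x y / dot_pair x x"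
  by (simp add: plane_def Im_divide dot_pair_def det_pair_eq power2_eq_square)

lemma signed_angle_swap:
  assumes "adjacent x y"
  shows "signed_angle y x = - signed_angle x y"
proof -
  have "Im (plane y / plane x) \<noteq> 0"
    using assms dot_pair_pos[OF assms] unfolding Im_plane_divide by (auto simp: adjacent_def)
  then have "plane y / plane x \<notin> \<real>" by (auto simp: complex_is_Real_iff)
  then show ?thesis
    unfolding signed_angle_def using Arg_inverse by (metis inverse_divide)
qed

text \<open>
  The jump of the angle is proportional to the determinant, so the combination
  \<open>(6/\<pi>) \<theta>(x, y) - 3 det(x, y)\<close> depends on \<open>y\<close> only up to sign.
\<close>

lemma signed_angle_minus:
  assumes "adjacent x y"
  shows "signed_angle x (- y) = signed_angle x y - pi * det_pair x y"
proof -
  let ?z = "plane y / plane x"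
  have im: "Im ?z = det_pair x y / dot_pair x x" by (rule Im_plane_divide)
  have pos: "0 < dot_pair x x" using assms by (rule dot_pair_pos)
  have *: "signed_angle x (- y) = (if Arg ?z \<le> 0 then Arg ?z + pi else Arg ?z - pi)"
    unfolding signed_angle_def using Arg_minus[of ?z] im pos assms
    by (force simp: adjacent_def)
  consider "det_pair x y = 1" | "det_pair x y = -1"
    using assms by (auto simp: adjacent_def abs_if split: if_splits)
  then show ?thesis
  proof cases
    case 1
    then have "0 < Arg ?z" using im pos Arg_lt_pi[of ?z] by simp
    with * 1 show ?thesis by (simp add: signed_angle_def)
  next
    case 2
    then have "Arg ?z < 0" using im pos Arg_neg_iff[of ?z] by simp
    with * 2 show ?thesis by (simp add: signed_angle_def)
  qed
qed

text \<open>
  The two angles lie between \<open>0\<close> and \<open>\<pi>\<close>. If their sum exceeded \<open>\<pi>\<close>, the angle from \<open>x\<close> to \<open>z\<close>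
  would be that sum minus \<open>2\<pi>\<close>, which is negative, contrary to the third determinant.
\<close>

lemma signed_angle_add:
  assumes "0 < det_pair x y" "0 < det_pair y z" "0 < det_pair x z"
  shows "signed_angle x z = signed_angle x y + signed_angle y z"
proof -
  have pos: "0 < dot_pair u u" if "0 < det_pair u w" for u w
    using that sum_squares_gt_zero_iff[of "u $ 1" "u $ 2"]
    by (force simp: det_pair_eq dot_pair_def)
  let ?p = "plane y / plane x" and ?q = "plane z / plane y"
  have arg: "0 < signed_angle u w" "signed_angle u w < pi" "plane u \<noteq> 0" "plane w / plane u \<noteq> 0"
    if "0 < det_pair u w" for u w
  proof -
    have im: "Im (plane w / plane u) > 0"
      unfolding Im_plane_divide using that pos[OF that] by simp
    then show "0 < signed_angle u w" "signed_angle u w < pi"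
      using Arg_lt_pi by (auto simp: signed_angle_def)
    show "plane w / plane u \<noteq> 0" using im by force
    then show "plane u \<noteq> 0" by auto
  qed
  have "plane z / plane x = ?p * ?q" using arg(3)[OF assms(2)] by simp
  then have "signed_angle x z = signed_angle x y + signed_angle y z +
      (if signed_angle x y + signed_angle y z \<in> {-pi<..pi} then 0
       else if signed_angle x y + signed_angle y z > pi then -2*pi else 2*pi)"
    unfolding signed_angle_def
    using Arg_times'[OF arg(4)[OF assms(1)] arg(4)[OF assms(2)]] by simp
  then show ?thesis
    using arg(1,2)[OF assms(1)] arg(1,2)[OF assms(2)] arg(1,2)[OF assms(3)]
    by (auto split: if_splits)
qed

section \<open>A weight on edges that vanishes around triangles\<close>

text \<open>
  The contribution of one step of the sequence to twelve times the difference between the two sides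
  of the rotation number formula, once each \<open>a\<^sub>i\<close> has been split between its two steps.
\<close>

definition edge_weight :: "int^2 \<Rightarrow> int^2 \<Rightarrow> real" where
  "edge_weight x y =
     6 / pi * signed_angle x y - 3 * det_pair x y
       + det_pair x y * dot_pair x y * (1 / dot_pair x x + 1 / dot_pair y y)"

lemma edge_weight_swap:
  assumes "adjacent x y"
  shows "edge_weight y x = - edge_weight x y"
  using signed_angle_swap[OF assms]
  by (simp add: edge_weight_def det_pair_commute[of x y] dot_pair_commute[of y x] algebra_simps)

lemma edge_weight_minus_right:
  assumes "adjacent x y"
  shows "edge_weight x (- y) = edge_weight x y"
  unfolding edge_weight_def signed_angle_minus[OF assms] by (simp add: field_simps)

lemma edge_weight_minus_left:
  assumes "adjacent x y"
  shows "edge_weight (- x) y = edge_weight x y"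
  using edge_weight_minus_right[of y x] edge_weight_swap[of y x] edge_weight_swap[of y "- x"] assms
  by (simp add: adjacent_commute)

text \<open>
  With \<open>det(x, y) = 1\<close>, \<open>a = \<bar>x\<bar>\<^sup>2\<close>, \<open>b = \<bar>y\<bar>\<^sup>2\<close>, \<open>m = \<langle>x, y\<rangle>\<close> and \<open>s = \<bar>x + y\<bar>\<^sup>2 = a + 2 m + b\<close>, the inner
  product terms exceed those of the edge from \<open>x\<close> to \<open>y\<close> by \<open>a/a + b/b + s/s = 3\<close>. This
  compensates for the determinants, whose terms are \<open>-6\<close> on the left and \<open>-3\<close> on the right. The
  coefficient \<open>3\<close> of the determinant comes from here.
\<close>

lemma edge_weight_add:
  assumes "adjacent x y"
  shows "edge_weight x (x + y) + edge_weight (x + y) y = edge_weight x y"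
proof -
  have oriented: "edge_weight x (x + y) + edge_weight (x + y) y = edge_weight x y"
    if "det_pair x y = 1" for x y
  proof -
    have det: "det_pair x (x + y) = 1" "det_pair (x + y) y = 1"
      using that by (simp_all add: det_pair_eq algebra_simps)
    have dot: "dot_pair x (x + y) = dot_pair x x + dot_pair x y"
      "dot_pair (x + y) y = dot_pair x y + dot_pair y y"
      "dot_pair (x + y) (x + y) = dot_pair x x + 2 * dot_pair x y + dot_pair y y"
      by (simp_all add: dot_pair_def algebra_simps)
    have pos: "0 < dot_pair x x" "0 < dot_pair y y" "0 < dot_pair x x + 2 * dot_pair x y + dot_pair y y"
      using dot_pair_pos[of x y] dot_pair_pos[of y x] dot_pair_pos[of "x + y" y] that det
        det_pair_commute[of x y]
      by (simp_all add: adjacent_def dot)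
    have angle: "signed_angle x y = signed_angle x (x + y) + signed_angle (x + y) y"
      using signed_angle_add[of x "x + y" y] det that by simp
    define a b m where abm: "a = real_of_int (dot_pair x x)" "b = real_of_int (dot_pair y y)"
      "m = real_of_int (dot_pair x y)"
    have "a > 0" "b > 0" "a + 2 * m + b > 0" using pos unfolding abm by linarith+
    then have "(a + m) * (1 / a + 1 / (a + 2 * m + b)) + (m + b) * (1 / (a + 2 * m + b) + 1 / b)
        = m * (1 / a + 1 / b) + 3"
      by (simp add: divide_simps) (simp add: algebra_simps)
    then show ?thesis
      unfolding edge_weight_def angle that det dot
      by (simp add: abm algebra_simps)
  qed
  consider "det_pair x y = 1" | "det_pair y x = 1"
    using assms by (auto simp: adjacent_def abs_if det_pair_commute[of x y] split: if_splits)
  then show ?thesis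
  proof cases
    case 2
    have "adjacent x (x + y)" "adjacent (x + y) y" "adjacent x y"
      using assms by (simp_all add: adjacent_def det_pair_eq algebra_simps)
    from this[THEN edge_weight_swap] oriented[OF 2] show ?thesis
      by (simp add: add.commute)
  qed (rule oriented)
qed

text \<open>
  Changing the signs of \<open>x\<close> and \<open>z\<close> turns every triangle of the Farey graph into one of the form
  \<open>x\<close>, \<open>x + y\<close>, \<open>y\<close>.
\<close>

lemma edge_weight_triangle:
  assumes "adjacent x y" "adjacent y z" "adjacent z x"
  shows "edge_weight x y + edge_weight y z + edge_weight z x = 0"
proof -
  have main: "edge_weight x z + edge_weight z y = edge_weight x y"
    if "z = x + y \<or> z = - x - y" "adjacent x y" for x y z
  proof -
    have adj: "adjacent x (x + y)" "adjacent (x + y) y"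
      using that(2) by (simp_all add: adjacent_def det_pair_eq algebra_simps)
    from that(1) consider "z = x + y" | "z = - (x + y)" by force
    then show ?thesis
      using edge_weight_add[OF that(2)] edge_weight_minus_right[OF adj(1)]
        edge_weight_minus_left[OF adj(2)] by cases simp_all
  qed
  have "edge_weight x z + edge_weight z y = edge_weight x y"
    using adjacent_triangle_linear[OF assms] main[of z x y] main[of z "- x" y]
      edge_weight_minus_left[of x y] edge_weight_minus_left[of x z] assms
    by (auto simp: adjacent_commute)
  then show ?thesis
    using edge_weight_swap[of z x] edge_weight_swap[of y z] assms by simp
qed

text \<open>
  A quarter turn has \<open>(6/\<pi>) \<theta> = \<plusminus>3\<close>, which cancels against the determinant.
\<close>

lemma edge_weight_unit:
  assumes "adjacent x y" "dot_pair x x = 1" "dot_pair y y = 1" "dot_pair x y = 0"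
  shows "edge_weight x y = 0"
proof -
  have re: "Re (plane y / plane x) = 0"
    using assms(2,4) by (simp add: plane_def Re_divide dot_pair_def power2_eq_square
      flip: of_int_mult of_int_add) (simp add: mult.commute)
  have im: "Im (plane y / plane x) = det_pair x y"
    unfolding Im_plane_divide using assms(2) by simp
  have z: "plane y / plane x = of_int (det_pair x y) * \<i>"
    using re im by (simp add: complex_eq_iff)
  have "det_pair x y = 1 \<or> det_pair x y = -1"
    using assms(1) by (auto simp: adjacent_def)
  then have "signed_angle x y = pi / 2 * det_pair x y"
    unfolding signed_angle_def z using Arg_minus[of \<i>] by (auto simp: Arg_ii)
  then show ?thesis using assms(4) by (simp add: edge_weight_def field_simps)
qed

section \<open>The edge weight as a difference of potentials\<close>

definition shorter_neighbour :: "int^2 \<Rightarrow> int^2 \<Rightarrow> bool" where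
  "shorter_neighbour y x \<longleftrightarrow> adjacent x y \<and> dot_pair x x < dot_pair y y"

definition parent :: "int^2 \<Rightarrow> int^2" where
  "parent y = (SOME x. shorter_neighbour y x)"

lemma shorter_neighbour_parent: "shorter_neighbour y x \<Longrightarrow> shorter_neighbour y (parent y)"
  unfolding parent_def by (rule someI)

text \<open>
  The sum of edge weights along one chosen path of vectors of increasing length that ends in \<open>y\<close>. Unit vectors
  have no shorter neighbour and get the value \<open>0\<close>, and so do the vectors that are not primitive,
  which lie on no edge.
\<close>

function potential :: "int^2 \<Rightarrow> real" where
  "potential y =
     (if \<exists>x. shorter_neighbour y x then potential (parent y) + edge_weight (parent y) y else 0)"
  by auto
termination
proof (relation "Wellfounded.measure (\<lambda>y. nat (dot_pair y y))")
  fix y assume "\<exists>x. shorter_neighbour y x"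
  then have "shorter_neighbour y (parent y)" using shorter_neighbour_parent by blast
  then show "(parent y, y) \<in> Wellfounded.measure (\<lambda>y. nat (dot_pair y y))"
    using dot_pair_pos by (force simp: shorter_neighbour_def)
qed simp

declare potential.simps [simp del]

lemma potential_step:
  "shorter_neighbour y x \<Longrightarrow> potential y = potential (parent y) + edge_weight (parent y) y"
  by (subst potential.simps) auto

lemma potential_minimal: "(\<And>x. \<not> shorter_neighbour y x) \<Longrightarrow> potential y = 0"
  by (subst potential.simps) auto

lemma potential_minus: "potential (- y) = potential y"
proof -
  have eq: "shorter_neighbour (- y) = shorter_neighbour y"
    by (simp add: shorter_neighbour_def fun_eq_iff)
  then have p: "parent (- y) = parent y" by (simp add: parent_def)
  show ?thesis
  proof (cases "\<exists>x. shorter_neighbour y x")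
    case True
    then obtain x where x: "shorter_neighbour y x" by blast
    then have "adjacent (parent y) y"
      using shorter_neighbour_parent shorter_neighbour_def by blast
    then show ?thesis
      using potential_step[of y x] potential_step[of "- y" x] x
      by (simp add: eq p edge_weight_minus_right)
  next
    case False
    then show ?thesis
      using potential_minimal[of y] potential_minimal[of "- y"] by (simp add: eq)
  qed
qed

text \<open>
  Induction on the squared lengths of the two ends. If \<open>w\<close> is the longer end of an edge from \<open>u\<close>,
  then \<open>u\<close> and the parent \<open>p\<close> of \<open>w\<close> are equal up to sign, and the claim is the recursion for the
  potential, or \<open>u\<close>, \<open>p\<close>, \<open>w\<close> form a triangle, and the claim for the smaller edge from \<open>u\<close> to \<open>p\<close>
  extends to the edge from \<open>u\<close> to \<open>w\<close>.
\<close>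

lemma edge_weight_eq_potential_diff:
  assumes "adjacent x y"
  shows "edge_weight x y = potential y - potential x"
  using assms
proof (induction "nat (dot_pair x x + dot_pair y y)" arbitrary: x y rule: less_induct)
  case less
  have pos: "0 < dot_pair x x" "0 < dot_pair y y"
    using less.prems dot_pair_pos adjacent_commute by blast+
  have step: "edge_weight u w = potential w - potential u"
    if uw: "adjacent u w" "dot_pair u u < dot_pair w w"
      and size: "dot_pair u u + dot_pair w w = dot_pair x x + dot_pair y y"
    for u w
  proof -
    have ex: "shorter_neighbour w u" using uw by (simp add: shorter_neighbour_def)
    define p where "p = parent w"
    have p: "adjacent p w" "dot_pair p p < dot_pair w w"
      using shorter_neighbour_parent[OF ex] by (simp_all add: p_def shorter_neighbour_def)
    have w: "potential w = potential p + edge_weight p w"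
      unfolding p_def by (rule potential_step[OF ex])
    consider "u = p" | "u = - p" | "adjacent u p"
      using shorter_neighbours[OF uw(1) p(1) uw(2) p(2)] by blast
    then show ?thesis
    proof cases
      case 2
      then show ?thesis using w edge_weight_minus_left[OF p(1)] potential_minus by simp
    next
      case 3
      have "dot_pair u u + dot_pair p p < dot_pair x x + dot_pair y y" using p(2) size by linarith
      then have "edge_weight u p = potential p - potential u"
        using less.hyps[OF _ 3] pos by simp
      moreover have "edge_weight u p + edge_weight p w + edge_weight w u = 0"
        using edge_weight_triangle 3 p(1) uw(1) adjacent_commute by blast
      ultimately show ?thesis using w edge_weight_swap[OF uw(1)] by simp
    qed (use w in simp)
  qed
  consider "dot_pair x x < dot_pair y y" | "dot_pair y y < dot_pair x x"
    | "dot_pair x x = dot_pair y y" by linarith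
  then show ?case
  proof cases
    case 1
    then show ?thesis using step less.prems by blast
  next
    case 2
    moreover have "adjacent y x" using less.prems adjacent_commute by blast
    ultimately show ?thesis
      using step[of y x] edge_weight_swap[OF less.prems] by simp
  next
    case 3
    note unit = adjacent_same_length[OF less.prems 3]
    have none: "\<not> shorter_neighbour w u" if "dot_pair w w = 1" for u w
      using that dot_pair_pos[of u w] by (auto simp: shorter_neighbour_def)
    have "potential x = 0" "potential y = 0"
      using none unit(2) 3 by (auto intro!: potential_minimal)
    then show ?thesis using edge_weight_unit[OF less.prems] unit 3 by simp
  qed
qed

section \<open>Summation along the closed sequence\<close>

lemma nxt_prv: "i < d \<Longrightarrow> nxt d (prv d i) = i"
  by (cases i) (simp_all add: nxt_def prv_def mod_Suc)

lemma prv_nxt: "i < d \<Longrightarrow> prv d (nxt d i) = i"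
  by (cases "Suc i = d") (auto simp: nxt_def prv_def)

lemma bij_betw_nxt: "bij_betw (nxt d) {..<d} {..<d}"
  by (rule bij_betwI[where g = "prv d"]) (auto simp: nxt_prv prv_nxt, auto simp: nxt_def prv_def)

lemma sum_nxt: "(\<Sum>i<d. f (nxt d i)) = (\<Sum>i<d. f i)"
  by (rule sum.reindex_bij_betw[OF bij_betw_nxt])

text \<open>
  The inner product of the relation that defines \<open>a\<^sub>i\<close> with \<open>v\<^sub>i\<close> splits \<open>a\<^sub>i\<close> into one term for
  each of the two steps at \<open>v\<^sub>i\<close>.
\<close>

lemma coeff_a_times_dot_pair:
  assumes "unimodular_seq d v" "i < d"
  shows "coeff_a d v i * dot_pair (v i) (v i) =
    - (eps d v (prv d i) * dot_pair (v (prv d i)) (v i) + eps d v i * dot_pair (v i) (v (nxt d i)))"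
proof -
  have "is_coeff d v i (coeff_a d v i)"
    unfolding coeff_a_def by (rule theI') (rule ex1_is_coeff[OF assms])
  then have "dot_pair (eps d v (prv d i) *s v (prv d i) + eps d v i *s v (nxt d i)
      + coeff_a d v i *s v i) (v i) = 0"
    by (simp add: is_coeff_def dot_pair_def)
  then show ?thesis by (simp add: dot_pair_def algebra_simps)
qed

theorem theorem1p2:
  fixes d :: nat and v :: "nat \<Rightarrow> int^2"
  assumes "d \<ge> 2" and "unimodular_seq d v"
  shows "rotation_number d v =
    1 / 12 * (real_of_int (\<Sum>i<d. coeff_a d v i) + 3 * real_of_int (\<Sum>i<d. eps d v i))"
proof -
  let ?n = "nxt d"
  define \<theta> where "\<theta> = (\<Sum>i<d. signed_angle (v i) (v (?n i)))"
  define c where "c i = real_of_int (eps d v i * dot_pair (v i) (v (?n i)))" for i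
  define q where "q i = real_of_int (dot_pair (v i) (v i))" for i
  have adj: "adjacent (v i) (v (?n i))" if "i < d" for i
    using assms(2) that by (auto simp: unimodular_seq_def adjacent_def empty_triangle_iff)
  have a: "real_of_int (coeff_a d v i) = - (c (prv d i) / q i + c i / q i)" if "i < d" for i
  proof -
    have "real_of_int (coeff_a d v i) * q i = - (c (prv d i) + c i)"
      using coeff_a_times_dot_pair[OF assms(2) that] nxt_prv[OF that]
      unfolding c_def q_def by (metis of_int_add of_int_minus of_int_mult)
    moreover have "q i \<noteq> 0" using dot_pair_pos[OF adj[OF that]] by (simp add: q_def)
    ultimately show ?thesis by (simp add: field_simps)
  qed
  \<comment> \<open>Each step from \<open>i\<close> to \<open>nxt d i\<close> collects its term in \<open>a\<close> at \<open>i\<close> and its term in \<open>a\<close> at \<open>nxt d i\<close>.\<close>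
  have "(\<Sum>i<d. c (prv d i) / q i) = (\<Sum>i<d. c i / q (?n i))"
    using sum_nxt[of "\<lambda>i. c (prv d i) / q i" d] by (simp add: prv_nxt)
  then have "real_of_int (\<Sum>i<d. coeff_a d v i) = - (\<Sum>i<d. c i * (1 / q i + 1 / q (?n i)))"
    by (simp add: a sum.distrib sum_negf sum_subtractf algebra_simps)
  moreover have "(\<Sum>i<d. edge_weight (v i) (v (?n i))) =
      6 / pi * \<theta> - 3 * real_of_int (\<Sum>i<d. eps d v i) + (\<Sum>i<d. c i * (1 / q i + 1 / q (?n i)))"
    by (simp add: edge_weight_def \<theta>_def c_def q_def eps_def sum.distrib sum_subtractf
        sum_distrib_left)
  moreover have "(\<Sum>i<d. edge_weight (v i) (v (?n i))) = (\<Sum>i<d. potential (v (?n i)) - potential (v i))"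
    using adj edge_weight_eq_potential_diff by simp
  then have "(\<Sum>i<d. edge_weight (v i) (v (?n i))) = 0"
    using sum_nxt[of "\<lambda>i. potential (v i)" d] by (simp add: sum_subtractf)
  ultimately have "6 / pi * \<theta> = real_of_int (\<Sum>i<d. coeff_a d v i) + 3 * real_of_int (\<Sum>i<d. eps d v i)"
    by linarith
  moreover have "rotation_number d v = 1 / 12 * (6 / pi * \<theta>)"
    by (simp add: rotation_number_def \<theta>_def)
  ultimately show ?thesis by simp
qed

end
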